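(* Let $d\ge0$ and let $n\ge2$. Let $\mathcal C_{d,n}$ denote the set of singular braids of the form $\tau_{i_1}\cdots\tau_{i_d}\beta$, where $1\le i_j\le n-1$ for $1\le j\le d$, and $\beta\in\mathcal B_n$. Then $\mathcal C_{d,n}$ spans $\mathcal H(S_dB_n)$ as a $\mathbb K$-vector space.
   Context: $\mathbb K=\mathbb C(q)$, with $q$ a variable. The singular braid monoid $SB_n$ is the monoid with generators $\sigma_1^{\pm1},\dots,\sigma_{n-1}^{\pm1},\tau_1,\dots,\tau_{n-1}$ and relations $\sigma_k\sigma_k^{-1}=\sigma_k^{-1}\sigma_k=1$, $\sigma_k\tau_k=\tau_k\sigma_k$; $\sigma_k\sigma_l\sigma_k=\sigma_l\sigma_k\sigma_l$ and $\sigma_k\sigma_l\tau_k=\tau_l\sigma_k\sigma_l$ if $|k-l|=1$; $\sigma_k\sigma_l=\sigma_l\sigma_k$, $\sigma_k\tau_l=\tau_l\sigma_k$, $\tau_k\tau_l=\tau_l\tau_k$ if $|k-l|\ge2$. $S_dB_n\subset SB_n$ is the set of elements represented by words with exactly $d$ letters $\tau_i$ (braids with $d$ singular points). The singular Hecke algebra $\mathcal H(SB_n)$ is the quotient of $\mathbb K[SB_n]$ by the relations $\sigma_k^2=(q-1)\sigma_k+q$, $1\le k\le n-1$, and $\mathcal H(S_dB_n)$ is the $\mathbb K$-linear subspace of $\mathcal H(SB_n)$ spanned by (the image of) $S_dB_n$. The sets $\mathcal B_n$ are defined as follows. For $n\ge2$, $\mathcal U_n=\{1,\sigma_{n-1},\sigma_{n-1}\sigma_{n-2},\dots,\sigma_{n-1}\sigma_{n-2}\cdots\sigma_2\sigma_1\}$;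 $\mathcal B_1=\{1\}$ and $\mathcal B_n=\{\beta u:\beta\in\mathcal B_{n-1},\,u\in\mathcal U_n\}$ for $n\ge2$. ($\mathcal B_n$ is a $\mathbb K$-basis of the usual Hecke algebra $\mathcal H(B_n)=\mathcal H(S_0B_n)$.) *)

theory Defs
  imports
    "HOL-Algebra.QuotRing"
    "HOL-Algebra.Module"
    "HOL-Algebra.Algebraic_Closure_Type"
    "HOL-Computational_Algebra.Fraction_Field"
    "HOL-Computational_Algebra.Polynomial"
begin

section \<open>The singular braid monoid\<close>

text \<open>
  \<open>Sig k\<close>, \<open>SigInv k\<close>, \<open>Tau k\<close> stand for \<open>\<sigma>\<^sub>k\<close>, \<open>\<sigma>\<^sub>k\<close> inverse and \<open>\<tau>\<^sub>k\<close>. The letters do not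
  depend on \<open>n\<close>, so that words on \<open>n\<close> strands are literally words on \<open>n + 1\<close> strands.
\<close>

datatype letter = Sig nat | SigInv nat | Tau nat

fun index :: "letter \<Rightarrow> nat" where
  "index (Sig k) = k"
| "index (SigInv k) = k"
| "index (Tau k) = k"

fun is_tau :: "letter \<Rightarrow> bool" where
  "is_tau (Tau k) = True"
| "is_tau _ = False"

definition words :: "nat \<Rightarrow> letter list set" where
  "words n = {w. \<forall>x\<in>set w. 1 \<le> index x \<and> index x \<le> n - 1}"

inductive_set sb_relations :: "nat \<Rightarrow> (letter list \<times> letter list) set" for n :: nat where
  sig_inv: "k \<in> {1..n-1} \<Longrightarrow> ([Sig k, SigInv k], []) \<in> sb_relations n"
| inv_sig: "k \<in> {1..n-1} \<Longrightarrow> ([SigInv k, Sig k], []) \<in> sb_relations n"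
| sig_tau: "k \<in> {1..n-1} \<Longrightarrow> ([Sig k, Tau k], [Tau k, Sig k]) \<in> sb_relations n"
| braid: "k \<in> {1..n-1} \<Longrightarrow> l \<in> {1..n-1} \<Longrightarrow> \<bar>int k - int l\<bar> = 1 \<Longrightarrow>
    ([Sig k, Sig l, Sig k], [Sig l, Sig k, Sig l]) \<in> sb_relations n"
| braid_tau: "k \<in> {1..n-1} \<Longrightarrow> l \<in> {1..n-1} \<Longrightarrow> \<bar>int k - int l\<bar> = 1 \<Longrightarrow>
    ([Sig k, Sig l, Tau k], [Tau l, Sig k, Sig l]) \<in> sb_relations n"
| far_sig_sig: "k \<in> {1..n-1} \<Longrightarrow> l \<in> {1..n-1} \<Longrightarrow> \<bar>int k - int l\<bar> \<ge> 2 \<Longrightarrow>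
    ([Sig k, Sig l], [Sig l, Sig k]) \<in> sb_relations n"
| far_sig_tau: "k \<in> {1..n-1} \<Longrightarrow> l \<in> {1..n-1} \<Longrightarrow> \<bar>int k - int l\<bar> \<ge> 2 \<Longrightarrow>
    ([Sig k, Tau l], [Tau l, Sig k]) \<in> sb_relations n"
| far_tau_tau: "k \<in> {1..n-1} \<Longrightarrow> l \<in> {1..n-1} \<Longrightarrow> \<bar>int k - int l\<bar> \<ge> 2 \<Longrightarrow>
    ([Tau k, Tau l], [Tau l, Tau k]) \<in> sb_relations n"

inductive_set sb_cong :: "nat \<Rightarrow> (letter list \<times> letter list) set" for n :: nat where
  rel: "(u, v) \<in> sb_relations n \<Longrightarrow> x \<in> words n \<Longrightarrow> y \<in> words n \<Longrightarrow>
    (x @ u @ y, x @ v @ y) \<in> sb_cong n"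
| refl: "w \<in> words n \<Longrightarrow> (w, w) \<in> sb_cong n"
| sym: "(u, v) \<in> sb_cong n \<Longrightarrow> (v, u) \<in> sb_cong n"
| trans: "(u, v) \<in> sb_cong n \<Longrightarrow> (v, w) \<in> sb_cong n \<Longrightarrow> (u, w) \<in> sb_cong n"

definition braid_class :: "nat \<Rightarrow> letter list \<Rightarrow> letter list set" where
  "braid_class n w = sb_cong n `` {w}"

definition SB :: "nat \<Rightarrow> letter list set monoid" where
  "SB n = \<lparr>carrier = words n // sb_cong n,
    monoid.mult = (\<lambda>A B. \<Union>x\<in>A. \<Union>y\<in>B. braid_class n (x @ y)),
    one = braid_class n []\<rparr>"

definition SdB :: "nat \<Rightarrow> nat \<Rightarrow> letter list set set" where
  "SdB d n = braid_class n ` {w \<in> words n. length (filter is_tau w) = d}"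

lemma words_simps [simp]:
  "[] \<in> words n"
  "x # w \<in> words n \<longleftrightarrow> 1 \<le> index x \<and> index x \<le> n - 1 \<and> w \<in> words n"
  "u @ v \<in> words n \<longleftrightarrow> u \<in> words n \<and> v \<in> words n"
  by (auto simp: words_def)

lemma sb_relations_words: "(u, v) \<in> sb_relations n \<Longrightarrow> u \<in> words n \<and> v \<in> words n"
  by (erule sb_relations.cases) simp_all

lemma sb_cong_words: "(u, v) \<in> sb_cong n \<Longrightarrow> u \<in> words n \<and> v \<in> words n"
  by (induction rule: sb_cong.induct) (auto dest: sb_relations_words)

lemma equiv_sb_cong: "equiv (words n) (sb_cong n)"
proof (rule equivI)
  show "sb_cong n \<subseteq> words n \<times> words n"
    by (auto dest: sb_cong_words)
  show "refl_on (words n) (sb_cong n)"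
    by (rule refl_onI) (rule sb_cong.refl)
  show "sym_on UNIV (sb_cong n)"
    by (rule symI) (rule sb_cong.sym)
  show "trans_on UNIV (sb_cong n)"
    by (rule transI) (rule sb_cong.trans)
qed

lemma sb_cong_context:
  assumes "(u, v) \<in> sb_cong n" "x \<in> words n" "y \<in> words n"
  shows "(x @ u @ y, x @ v @ y) \<in> sb_cong n"
  using assms
proof (induction rule: sb_cong.induct)
  case (rel u v x' y')
  then show ?case using sb_cong.rel[of u v n "x @ x'" "y' @ y"] by simp
next
  case (refl w)
  then show ?case by (simp add: sb_cong.refl)
qed (blast intro: sb_cong.sym sb_cong.trans)+

lemma sb_cong_append:
  assumes "(u, u') \<in> sb_cong n" "(v, v') \<in> sb_cong n"
  shows "(u @ v, u' @ v') \<in> sb_cong n"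
proof -
  have "u \<in> words n" "v' \<in> words n"
    using assms sb_cong_words by blast+
  then show ?thesis
    using sb_cong_context[OF assms(1), of "[]" v'] sb_cong_context[OF assms(2), of u "[]"]
    by (metis append_Nil append_Nil2 sb_cong.trans words_simps(1))
qed

lemma braid_class_eq_iff:
  "u \<in> words n \<Longrightarrow> v \<in> words n \<Longrightarrow> braid_class n u = braid_class n v \<longleftrightarrow> (u, v) \<in> sb_cong n"
  unfolding braid_class_def by (rule eq_equiv_class_iff[OF equiv_sb_cong])

lemma carrier_SB: "carrier (SB n) = braid_class n ` words n"
  by (auto simp: SB_def quotient_def braid_class_def)

lemma one_SB: "\<one>\<^bsub>SB n\<^esub> = braid_class n []"
  by (simp add: SB_def)

lemma mult_SB:
  assumes "u \<in> words n" "v \<in> words n"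
  shows "braid_class n u \<otimes>\<^bsub>SB n\<^esub> braid_class n v = braid_class n (u @ v)"
proof -
  have eq: "braid_class n (x @ y) = braid_class n (u @ v)"
    if "x \<in> braid_class n u" "y \<in> braid_class n v" for x y
  proof -
    have "(u, x) \<in> sb_cong n" "(v, y) \<in> sb_cong n"
      using that by (auto simp: braid_class_def)
    then have "(u @ v, x @ y) \<in> sb_cong n"
      by (rule sb_cong_append)
    then show ?thesis
      unfolding braid_class_def by (rule equiv_class_eq[OF equiv_sb_cong, symmetric])
  qed
  have ne: "u \<in> braid_class n u" "v \<in> braid_class n v"
    using assms by (auto simp: braid_class_def intro: sb_cong.refl)
  have "(\<Union>x\<in>braid_class n u. \<Union>y\<in>braid_class n v. braid_class n (x @ y)) =
      (\<Union>x\<in>braid_class n u. \<Union>y\<in>braid_class n v. braid_class n (u @ v))"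
    by (intro SUP_cong HOL.refl eq)
  also have "\<dots> = braid_class n (u @ v)"
    using ne by blast
  finally show ?thesis
    by (simp add: SB_def)
qed

lemma monoid_SB: "Group.monoid (SB n)"
  by (rule monoidI) (auto simp: carrier_SB one_SB mult_SB)


section \<open>Monoid algebras, quotient algebras and linear spans\<close>

definition supp :: "('m \<Rightarrow> 'k::zero) \<Rightarrow> 'm set" where
  "supp f = {x. f x \<noteq> 0}"

text \<open>The elements are the finitely supported functions on the carrier, extended by 0.\<close>

definition monoid_algebra :: "('m, 'b) monoid_scheme \<Rightarrow> ('k::comm_ring_1, 'm \<Rightarrow> 'k) module" where
  "monoid_algebra M =
    \<lparr>carrier = {f. finite (supp f) \<and> supp f \<subseteq> carrier M},
     monoid.mult = (\<lambda>f g x. \<Sum>y\<in>supp f. \<Sum>z\<in>supp g. if y \<otimes>\<^bsub>M\<^esub> z = x then f y * g z else 0),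
     one = (\<lambda>x. if x = \<one>\<^bsub>M\<^esub> then 1 else 0),
     ring.zero = (\<lambda>x. 0),
     add = (\<lambda>f g x. f x + g x),
     module.smult = (\<lambda>a f x. a * f x)\<rparr>"

definition delta :: "'m \<Rightarrow> 'm \<Rightarrow> 'k::zero_neq_one" where
  "delta m = (\<lambda>x. if x = m then 1 else 0)"

definition quot_algebra :: "('k, 'a, 'b) module_scheme \<Rightarrow> 'a set \<Rightarrow> ('k, 'a set) module" where
  "quot_algebra A I = ring.extend (A Quot I)
    \<lparr>module.smult = (\<lambda>a S. \<Union>x\<in>S. I +>\<^bsub>A\<^esub> (a \<odot>\<^bsub>A\<^esub> x))\<rparr>"

definition linear_span ::
  "('k, 'c) ring_scheme \<Rightarrow> ('k, 'a, 'b) module_scheme \<Rightarrow> 'a set \<Rightarrow> 'a set" where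
  "linear_span R V S = (\<lambda>W. submodule W R V) hull S"

lemma supp_bound:
  assumes "finite A" "supp f \<subseteq> A"
  shows "(\<Sum>y\<in>supp f. f y * h y) = (\<Sum>y\<in>A. f y * (h y :: 'k::comm_ring_1))"
  using assms by (intro sum.mono_neutral_left) (auto simp: supp_def)

lemma monoid_algebra_mult:
  assumes "finite A" "finite B" "supp f \<subseteq> A" "supp g \<subseteq> B"
  shows "(f \<otimes>\<^bsub>monoid_algebra M\<^esub> g) x =
    (\<Sum>y\<in>A. \<Sum>z\<in>B. f y * g z * (if y \<otimes>\<^bsub>M\<^esub> z = x then 1 else 0))"
proof -
  have "(f \<otimes>\<^bsub>monoid_algebra M\<^esub> g) x =
      (\<Sum>y\<in>supp f. f y * (\<Sum>z\<in>supp g. g z * (if y \<otimes>\<^bsub>M\<^esub> z = x then 1 else 0)))"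
    by (auto simp: monoid_algebra_def sum_distrib_left intro!: sum.cong)
  also have "\<dots> = (\<Sum>y\<in>A. f y * (\<Sum>z\<in>B. g z * (if y \<otimes>\<^bsub>M\<^esub> z = x then 1 else 0)))"
    unfolding supp_bound[OF assms(2,4)] supp_bound[OF assms(1,3)] ..
  finally show ?thesis
    by (simp add: sum_distrib_left mult.assoc)
qed

lemma supp_mult:
  "supp (f \<otimes>\<^bsub>monoid_algebra M\<^esub> g) \<subseteq> (\<lambda>(y, z). y \<otimes>\<^bsub>M\<^esub> z) ` (supp f \<times> supp g)"
proof
  fix x assume "x \<in> supp (f \<otimes>\<^bsub>monoid_algebra M\<^esub> g)"
  then have "(\<Sum>y\<in>supp f. \<Sum>z\<in>supp g. if y \<otimes>\<^bsub>M\<^esub> z = x then f y * g z else 0) \<noteq> 0"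
    by (simp add: supp_def monoid_algebra_def)
  then obtain y where y: "y \<in> supp f"
      "(\<Sum>z\<in>supp g. if y \<otimes>\<^bsub>M\<^esub> z = x then f y * g z else 0) \<noteq> 0"
    by (rule sum.not_neutral_contains_not_neutral)
  then obtain z where z: "z \<in> supp g" "(if y \<otimes>\<^bsub>M\<^esub> z = x then f y * g z else 0) \<noteq> 0"
    by (blast elim: sum.not_neutral_contains_not_neutral)
  then have "x = y \<otimes>\<^bsub>M\<^esub> z"
    by (metis (full_types))
  with y(1) z(1) show "x \<in> (\<lambda>(y, z). y \<otimes>\<^bsub>M\<^esub> z) ` (supp f \<times> supp g)"
    by (intro image_eqI[of _ _ "(y, z)"]) simp_all
qed

lemma supp_simps:
  "supp (\<lambda>x. 0) = {}"
  "supp (\<lambda>x. f x + g x) \<subseteq> supp f \<union> supp (g :: 'm \<Rightarrow> 'k::comm_ring_1)"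
  "supp (\<lambda>x. a * f x) \<subseteq> supp (f :: 'm \<Rightarrow> 'k::comm_ring_1)"
  "supp (\<lambda>x. - f x) = supp (f :: 'm \<Rightarrow> 'k::comm_ring_1)"
  "supp (delta m :: 'm \<Rightarrow> 'k::comm_ring_1) = {m}"
  "supp (\<lambda>x. if x = m then 1 else (0::'k::comm_ring_1)) = {m}"
  by (auto simp: supp_def delta_def)

lemma monoid_algebra_assoc:
  fixes f g h :: "'m \<Rightarrow> 'k::comm_ring_1"
  assumes "Group.monoid M" and "f \<in> carrier (monoid_algebra M)"
    and "g \<in> carrier (monoid_algebra M)" "h \<in> carrier (monoid_algebra M)"
  shows "f \<otimes>\<^bsub>monoid_algebra M\<^esub> g \<otimes>\<^bsub>monoid_algebra M\<^esub> h =
    f \<otimes>\<^bsub>monoid_algebra M\<^esub> (g \<otimes>\<^bsub>monoid_algebra M\<^esub> h)"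
proof
  fix x
  interpret Group.monoid M by fact
  define F where "F = supp f"
  define G where "G = supp g"
  define H where "H = supp h"
  have fin: "finite F" "finite G" "finite H"
    and sub: "F \<subseteq> carrier M" "G \<subseteq> carrier M" "H \<subseteq> carrier M"
    using assms by (auto simp: monoid_algebra_def F_def G_def H_def)
  define P where "P = (\<lambda>(y, z). y \<otimes>\<^bsub>M\<^esub> z) ` (F \<times> G)"
  define Q where "Q = (\<lambda>(y, z). y \<otimes>\<^bsub>M\<^esub> z) ` (G \<times> H)"
  have PQ: "finite P" "finite Q"
    using fin by (auto simp: P_def Q_def)
  note fg = monoid_algebra_mult[OF fin(1,2) eq_refl[OF F_def[symmetric]] eq_refl[OF G_def[symmetric]]]
  note gh = monoid_algebra_mult[OF fin(2,3) eq_refl[OF G_def[symmetric]] eq_refl[OF H_def[symmetric]]]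
  let ?i = "\<lambda>a b. if a = b then 1 else (0::'k)"
  have "(f \<otimes>\<^bsub>monoid_algebra M\<^esub> g \<otimes>\<^bsub>monoid_algebra M\<^esub> h) x =
      (\<Sum>p\<in>P. \<Sum>w\<in>H. (f \<otimes>\<^bsub>monoid_algebra M\<^esub> g) p * h w * ?i (p \<otimes>\<^bsub>M\<^esub> w) x)"
    by (rule monoid_algebra_mult)
      (use PQ fin supp_mult[of M f g] in \<open>simp_all add: P_def F_def G_def H_def\<close>)
  also have "\<dots> = (\<Sum>p\<in>P. \<Sum>w\<in>H. \<Sum>y\<in>F. \<Sum>z\<in>G.
      f y * g z * h w * (?i (y \<otimes>\<^bsub>M\<^esub> z) p * ?i (p \<otimes>\<^bsub>M\<^esub> w) x))"
    unfolding fg sum_distrib_right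
    by (intro sum.cong HOL.refl) (simp only: mult.assoc mult.commute mult.left_commute)
  also have "\<dots> = (\<Sum>w\<in>H. \<Sum>p\<in>P. \<Sum>y\<in>F. \<Sum>z\<in>G.
      f y * g z * h w * (?i (y \<otimes>\<^bsub>M\<^esub> z) p * ?i (p \<otimes>\<^bsub>M\<^esub> w) x))"
    by (rule sum.swap)
  also have "\<dots> = (\<Sum>w\<in>H. \<Sum>y\<in>F. \<Sum>p\<in>P. \<Sum>z\<in>G.
      f y * g z * h w * (?i (y \<otimes>\<^bsub>M\<^esub> z) p * ?i (p \<otimes>\<^bsub>M\<^esub> w) x))"
    by (rule sum.cong[OF HOL.refl], rule sum.swap)
  also have "\<dots> = (\<Sum>w\<in>H. \<Sum>y\<in>F. \<Sum>z\<in>G. \<Sum>p\<in>P.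
      f y * g z * h w * (?i (y \<otimes>\<^bsub>M\<^esub> z) p * ?i (p \<otimes>\<^bsub>M\<^esub> w) x))"
    by (rule sum.cong[OF HOL.refl], rule sum.cong[OF HOL.refl], rule sum.swap)
  also have "\<dots> = (\<Sum>w\<in>H. \<Sum>y\<in>F. \<Sum>z\<in>G. f y * g z * h w * ?i (y \<otimes>\<^bsub>M\<^esub> z \<otimes>\<^bsub>M\<^esub> w) x)"
  proof (intro sum.cong HOL.refl)
    fix w y z assume "y \<in> F" "z \<in> G"
    then have "y \<otimes>\<^bsub>M\<^esub> z \<in> P"
      by (force simp: P_def)
    moreover have "f y * g z * h w * (?i (y \<otimes>\<^bsub>M\<^esub> z) p * ?i (p \<otimes>\<^bsub>M\<^esub> w) x) =
        (if y \<otimes>\<^bsub>M\<^esub> z = p then f y * g z * h w * ?i (y \<otimes>\<^bsub>M\<^esub> z \<otimes>\<^bsub>M\<^esub> w) x else 0)" for p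
      by simp
    ultimately show "(\<Sum>p\<in>P. f y * g z * h w * (?i (y \<otimes>\<^bsub>M\<^esub> z) p * ?i (p \<otimes>\<^bsub>M\<^esub> w) x)) =
        f y * g z * h w * ?i (y \<otimes>\<^bsub>M\<^esub> z \<otimes>\<^bsub>M\<^esub> w) x"
      using PQ by (simp only: sum.delta' if_True)
  qed
  also have "\<dots> = (\<Sum>y\<in>F. \<Sum>w\<in>H. \<Sum>z\<in>G. f y * g z * h w * ?i (y \<otimes>\<^bsub>M\<^esub> z \<otimes>\<^bsub>M\<^esub> w) x)"
    by (rule sum.swap)
  also have "\<dots> = (\<Sum>y\<in>F. \<Sum>z\<in>G. \<Sum>w\<in>H. f y * g z * h w * ?i (y \<otimes>\<^bsub>M\<^esub> z \<otimes>\<^bsub>M\<^esub> w) x)"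
    by (rule sum.cong[OF HOL.refl], rule sum.swap)
  also have "\<dots> = (\<Sum>y\<in>F. \<Sum>z\<in>G. \<Sum>w\<in>H. f y * g z * h w * ?i (y \<otimes>\<^bsub>M\<^esub> (z \<otimes>\<^bsub>M\<^esub> w)) x)"
    using sub by (intro sum.cong HOL.refl) (metis m_assoc subsetD)
  also have "\<dots> = (\<Sum>y\<in>F. \<Sum>z\<in>G. \<Sum>w\<in>H. \<Sum>p\<in>Q.
      f y * g z * h w * (?i (z \<otimes>\<^bsub>M\<^esub> w) p * ?i (y \<otimes>\<^bsub>M\<^esub> p) x))"
  proof (intro sum.cong HOL.refl)
    fix w y z assume "w \<in> H" "z \<in> G"
    then have "z \<otimes>\<^bsub>M\<^esub> w \<in> Q"
      by (force simp: Q_def)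
    moreover have "f y * g z * h w * (?i (z \<otimes>\<^bsub>M\<^esub> w) p * ?i (y \<otimes>\<^bsub>M\<^esub> p) x) =
        (if z \<otimes>\<^bsub>M\<^esub> w = p then f y * g z * h w * ?i (y \<otimes>\<^bsub>M\<^esub> (z \<otimes>\<^bsub>M\<^esub> w)) x else 0)" for p
      by simp
    ultimately show "f y * g z * h w * ?i (y \<otimes>\<^bsub>M\<^esub> (z \<otimes>\<^bsub>M\<^esub> w)) x =
        (\<Sum>p\<in>Q. f y * g z * h w * (?i (z \<otimes>\<^bsub>M\<^esub> w) p * ?i (y \<otimes>\<^bsub>M\<^esub> p) x))"
      using PQ by (simp only: sum.delta' if_True)
  qed
  also have "\<dots> = (\<Sum>y\<in>F. \<Sum>z\<in>G. \<Sum>p\<in>Q. \<Sum>w\<in>H.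
      f y * g z * h w * (?i (z \<otimes>\<^bsub>M\<^esub> w) p * ?i (y \<otimes>\<^bsub>M\<^esub> p) x))"
    by (rule sum.cong[OF HOL.refl], rule sum.cong[OF HOL.refl], rule sum.swap)
  also have "\<dots> = (\<Sum>y\<in>F. \<Sum>p\<in>Q. \<Sum>z\<in>G. \<Sum>w\<in>H.
      f y * g z * h w * (?i (z \<otimes>\<^bsub>M\<^esub> w) p * ?i (y \<otimes>\<^bsub>M\<^esub> p) x))"
    by (rule sum.cong[OF HOL.refl], rule sum.swap)
  also have "\<dots> = (\<Sum>y\<in>F. \<Sum>p\<in>Q. f y * (g \<otimes>\<^bsub>monoid_algebra M\<^esub> h) p * ?i (y \<otimes>\<^bsub>M\<^esub> p) x)"
    unfolding gh sum_distrib_right sum_distrib_left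
    by (intro sum.cong HOL.refl) (simp only: mult.assoc mult.commute mult.left_commute)
  also have "\<dots> = (f \<otimes>\<^bsub>monoid_algebra M\<^esub> (g \<otimes>\<^bsub>monoid_algebra M\<^esub> h)) x"
    by (rule monoid_algebra_mult[symmetric])
      (use PQ fin supp_mult[of M g h] in \<open>simp_all add: Q_def F_def G_def H_def\<close>)
  finally show "(f \<otimes>\<^bsub>monoid_algebra M\<^esub> g \<otimes>\<^bsub>monoid_algebra M\<^esub> h) x =
    (f \<otimes>\<^bsub>monoid_algebra M\<^esub> (g \<otimes>\<^bsub>monoid_algebra M\<^esub> h)) x" .
qed

lemma carrier_monoid_algebra:
  "f \<in> carrier (monoid_algebra M) \<longleftrightarrow> finite (supp f) \<and> supp f \<subseteq> carrier M"
  by (simp add: monoid_algebra_def)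

lemma monoid_algebra_simps:
  "\<one>\<^bsub>monoid_algebra M\<^esub> = delta \<one>\<^bsub>M\<^esub>"
  "\<zero>\<^bsub>monoid_algebra M\<^esub> = (\<lambda>x. 0)"
  "f \<oplus>\<^bsub>monoid_algebra M\<^esub> g = (\<lambda>x. f x + g x)"
  "a \<odot>\<^bsub>monoid_algebra M\<^esub> f = (\<lambda>x. a * f x)"
  by (simp_all add: monoid_algebra_def delta_def)

lemma delta_mult:
  "delta a \<otimes>\<^bsub>monoid_algebra M\<^esub> delta b = (delta (a \<otimes>\<^bsub>M\<^esub> b) :: 'm \<Rightarrow> 'k::comm_ring_1)"
  by (rule ext, subst monoid_algebra_mult[of "{a}" "{b}"]) (auto simp: supp_simps delta_def)

lemma add_closed:
  fixes f g :: "'m \<Rightarrow> 'k::comm_ring_1"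
  assumes "f \<in> carrier (monoid_algebra M)" "g \<in> carrier (monoid_algebra M)"
  shows "(\<lambda>x. f x + g x) \<in> carrier (monoid_algebra M)"
proof -
  have "finite (supp f \<union> supp g)" "supp f \<union> supp g \<subseteq> carrier M"
    using assms by (auto simp: carrier_monoid_algebra)
  then show ?thesis
    unfolding carrier_monoid_algebra using supp_simps(2)[of f g] by (meson finite_subset subset_trans)
qed

lemma smult_closed:
  fixes f :: "'m \<Rightarrow> 'k::comm_ring_1"
  assumes "f \<in> carrier (monoid_algebra M)"
  shows "(\<lambda>x. a * f x) \<in> carrier (monoid_algebra M)"
  using assms supp_simps(3)[of a f] unfolding carrier_monoid_algebra
  by (meson finite_subset subset_trans)

lemma abelian_group_monoid_algebra:
  "abelian_group (monoid_algebra M :: ('k::comm_ring_1, 'm \<Rightarrow> 'k) module)"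
proof (rule abelian_groupI)
  fix f :: "'m \<Rightarrow> 'k" assume "f \<in> carrier (monoid_algebra M)"
  then have "(\<lambda>x. - f x) \<in> carrier (monoid_algebra M)"
    by (simp add: carrier_monoid_algebra supp_simps)
  then show "\<exists>g\<in>carrier (monoid_algebra M). g \<oplus>\<^bsub>monoid_algebra M\<^esub> f = \<zero>\<^bsub>monoid_algebra M\<^esub>"
    by (rule bexI[rotated]) (simp add: monoid_algebra_simps)
next
  show "\<zero>\<^bsub>monoid_algebra M\<^esub> \<in> carrier (monoid_algebra M :: ('k, 'm \<Rightarrow> 'k) module)"
    by (simp add: carrier_monoid_algebra monoid_algebra_simps supp_simps)
qed (auto simp: monoid_algebra_simps add_closed algebra_simps)

lemma ring_monoid_algebra:
  assumes "Group.monoid M"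
  shows "ring (monoid_algebra M :: ('k::comm_ring_1, 'm \<Rightarrow> 'k) module)"
proof -
  interpret M: Group.monoid M by fact
  let ?A = "monoid_algebra M :: ('k, 'm \<Rightarrow> 'k) module"
  have mult: "f \<otimes>\<^bsub>?A\<^esub> g \<in> carrier ?A" if "f \<in> carrier ?A" "g \<in> carrier ?A" for f g
  proof -
    have "finite ((\<lambda>(y, z). y \<otimes>\<^bsub>M\<^esub> z) ` (supp f \<times> supp g))"
      "(\<lambda>(y, z). y \<otimes>\<^bsub>M\<^esub> z) ` (supp f \<times> supp g) \<subseteq> carrier M"
      using that by (auto simp: carrier_monoid_algebra)
    then show ?thesis
      unfolding carrier_monoid_algebra using supp_mult[of M f g] by (meson finite_subset subset_trans)
  qed
  have one: "\<one>\<^bsub>?A\<^esub> \<in> carrier ?A"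
    by (simp add: carrier_monoid_algebra monoid_algebra_simps supp_simps)
  have unit: "\<one>\<^bsub>?A\<^esub> \<otimes>\<^bsub>?A\<^esub> f = f" "f \<otimes>\<^bsub>?A\<^esub> \<one>\<^bsub>?A\<^esub> = f" if f: "f \<in> carrier ?A" for f
  proof -
    have fin: "finite (supp f)" and sub: "supp f \<subseteq> carrier M"
      using f by (auto simp: carrier_monoid_algebra)
    have "(\<one>\<^bsub>?A\<^esub> \<otimes>\<^bsub>?A\<^esub> f) x = f x \<and> (f \<otimes>\<^bsub>?A\<^esub> \<one>\<^bsub>?A\<^esub>) x = f x" for x
    proof -
      have "(\<one>\<^bsub>?A\<^esub> \<otimes>\<^bsub>?A\<^esub> f) x = (\<Sum>y\<in>supp f. f y * (if \<one>\<^bsub>M\<^esub> \<otimes>\<^bsub>M\<^esub> y = x then 1 else 0))"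
        by (subst monoid_algebra_mult[of "{\<one>\<^bsub>M\<^esub>}" "supp f"])
          (use fin in \<open>auto simp: monoid_algebra_simps supp_simps delta_def\<close>)
      also have "\<dots> = (\<Sum>y\<in>supp f. if y = x then f y else 0)"
        using sub by (intro sum.cong) auto
      moreover have "(f \<otimes>\<^bsub>?A\<^esub> \<one>\<^bsub>?A\<^esub>) x =
          (\<Sum>y\<in>supp f. f y * (if y \<otimes>\<^bsub>M\<^esub> \<one>\<^bsub>M\<^esub> = x then 1 else 0))"
        by (subst monoid_algebra_mult[of "supp f" "{\<one>\<^bsub>M\<^esub>}"])
          (use fin in \<open>auto simp: monoid_algebra_simps supp_simps delta_def\<close>)
      moreover have "\<dots> = (\<Sum>y\<in>supp f. if y = x then f y else 0)"
        using sub by (intro sum.cong) auto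
      moreover have "(\<Sum>y\<in>supp f. if y = x then f y else 0) = f x"
        using fin by (simp add: supp_def)
      ultimately show ?thesis by simp
    qed
    then show "\<one>\<^bsub>?A\<^esub> \<otimes>\<^bsub>?A\<^esub> f = f" "f \<otimes>\<^bsub>?A\<^esub> \<one>\<^bsub>?A\<^esub> = f" by blast+
  qed
  show ?thesis
  proof (rule ringI)
    show "abelian_group ?A" by (rule abelian_group_monoid_algebra)
    show "Group.monoid ?A"
      using mult one unit monoid_algebra_assoc[OF assms] by (intro monoidI) auto
  next
    fix f g h assume fgh: "f \<in> carrier ?A" "g \<in> carrier ?A" "h \<in> carrier ?A"
    define S where "S = supp f \<union> supp g"
    have S: "finite S" "supp f \<subseteq> S" "supp g \<subseteq> S" "supp (\<lambda>x. f x + g x) \<subseteq> S" "finite (supp h)"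
      using fgh supp_simps(2)[of f g] by (auto simp: S_def carrier_monoid_algebra)
    show "(f \<oplus>\<^bsub>?A\<^esub> g) \<otimes>\<^bsub>?A\<^esub> h = f \<otimes>\<^bsub>?A\<^esub> h \<oplus>\<^bsub>?A\<^esub> g \<otimes>\<^bsub>?A\<^esub> h"
      unfolding monoid_algebra_simps
    proof
      fix x
      show "((\<lambda>x. f x + g x) \<otimes>\<^bsub>?A\<^esub> h) x = (f \<otimes>\<^bsub>?A\<^esub> h) x + (g \<otimes>\<^bsub>?A\<^esub> h) x"
        unfolding monoid_algebra_mult[OF S(1) S(5) S(4) order.refl]
          monoid_algebra_mult[OF S(1) S(5) S(2) order.refl]
          monoid_algebra_mult[OF S(1) S(5) S(3) order.refl]
        by (simp only: distrib_right sum.distrib)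
    qed
    show "h \<otimes>\<^bsub>?A\<^esub> (f \<oplus>\<^bsub>?A\<^esub> g) = h \<otimes>\<^bsub>?A\<^esub> f \<oplus>\<^bsub>?A\<^esub> h \<otimes>\<^bsub>?A\<^esub> g"
      unfolding monoid_algebra_simps
    proof
      fix x
      show "(h \<otimes>\<^bsub>?A\<^esub> (\<lambda>x. f x + g x)) x = (h \<otimes>\<^bsub>?A\<^esub> f) x + (h \<otimes>\<^bsub>?A\<^esub> g) x"
        unfolding monoid_algebra_mult[OF S(5) S(1) order.refl S(4)]
          monoid_algebra_mult[OF S(5) S(1) order.refl S(2)]
          monoid_algebra_mult[OF S(5) S(1) order.refl S(3)]
        by (simp only: distrib_right distrib_left sum.distrib)
    qed
  qed
qed

lemma smult_mult:
  fixes f g :: "'m \<Rightarrow> 'k::comm_ring_1"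
  assumes "f \<in> carrier (monoid_algebra M)" "g \<in> carrier (monoid_algebra M)"
  shows "(a \<odot>\<^bsub>monoid_algebra M\<^esub> f) \<otimes>\<^bsub>monoid_algebra M\<^esub> g =
    a \<odot>\<^bsub>monoid_algebra M\<^esub> (f \<otimes>\<^bsub>monoid_algebra M\<^esub> g)"
proof -
  have fin: "finite (supp f)" "finite (supp g)"
    using assms by (auto simp: carrier_monoid_algebra)
  show ?thesis
    unfolding monoid_algebra_simps
  proof
    fix x
    show "((\<lambda>x. a * f x) \<otimes>\<^bsub>monoid_algebra M\<^esub> g) x = a * (f \<otimes>\<^bsub>monoid_algebra M\<^esub> g) x"
      unfolding monoid_algebra_mult[OF fin supp_simps(3) order.refl]
        monoid_algebra_mult[OF fin order.refl order.refl]
      by (simp only: sum_distrib_left mult.assoc)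
  qed
qed

lemma ring_of_type_algebra_simps:
  "carrier ring_of_type_algebra = UNIV"
  "a \<oplus>\<^bsub>ring_of_type_algebra\<^esub> b = a + b"
  "a \<otimes>\<^bsub>ring_of_type_algebra\<^esub> b = a * b"
  "\<one>\<^bsub>ring_of_type_algebra\<^esub> = 1"
  by (simp_all add: ring_of_type_algebra_def)

lemma module_monoid_algebra:
  "module (ring_of_type_algebra :: 'k ring)
    (monoid_algebra M :: ('k::comm_ring_1, 'm \<Rightarrow> 'k) module)"
  by (rule moduleI)
    (auto simp: monoid_algebra_simps ring_of_type_algebra_simps smult_closed algebra_simps
      abelian_group_monoid_algebra)

lemma quot_algebra_simps:
  "carrier (quot_algebra A I) = carrier (A Quot I)"
  "\<zero>\<^bsub>quot_algebra A I\<^esub> = \<zero>\<^bsub>A Quot I\<^esub>"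
  "\<one>\<^bsub>quot_algebra A I\<^esub> = \<one>\<^bsub>A Quot I\<^esub>"
  "x \<oplus>\<^bsub>quot_algebra A I\<^esub> y = x \<oplus>\<^bsub>A Quot I\<^esub> y"
  "x \<otimes>\<^bsub>quot_algebra A I\<^esub> y = x \<otimes>\<^bsub>A Quot I\<^esub> y"
  by (simp_all add: quot_algebra_def ring.defs)

lemma ring_quot_algebra:
  assumes "ideal I A"
  shows "ring (quot_algebra A I)"
proof -
  interpret Q: ring "A Quot I"
    using assms by (rule ideal.quotient_is_ring)
  show ?thesis
  proof (rule ringI)
    show "abelian_group (quot_algebra A I)"
      by (rule abelian_groupI)
        (simp_all add: quot_algebra_simps Q.add.m_ac Q.add.l_inv_ex)
    show "Group.monoid (quot_algebra A I)"
      by (rule monoidI) (auto simp: quot_algebra_simps Q.m_assoc)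
  qed (auto simp: quot_algebra_simps Q.l_distr Q.r_distr)
qed

lemma quot_algebra_smult:
  assumes "ideal I A" "module R A" "a \<in> carrier R" "x \<in> carrier A"
    and "\<And>y. y \<in> I \<Longrightarrow> a \<odot>\<^bsub>A\<^esub> y \<in> I"
  shows "a \<odot>\<^bsub>quot_algebra A I\<^esub> (I +>\<^bsub>A\<^esub> x) = I +>\<^bsub>A\<^esub> (a \<odot>\<^bsub>A\<^esub> x)"
proof -
  interpret ideal I A by fact
  interpret M: module R A by fact
  have eq: "I +>\<^bsub>A\<^esub> (a \<odot>\<^bsub>A\<^esub> z) = I +>\<^bsub>A\<^esub> (a \<odot>\<^bsub>A\<^esub> x)" if z: "z \<in> I +>\<^bsub>A\<^esub> x" for z
  proof -
    obtain y where y: "y \<in> I" "z = y \<oplus>\<^bsub>A\<^esub> x"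
      using z by (auto simp: a_r_coset_def')
    then have "a \<odot>\<^bsub>A\<^esub> z = a \<odot>\<^bsub>A\<^esub> y \<oplus>\<^bsub>A\<^esub> a \<odot>\<^bsub>A\<^esub> x"
      using assms(3,4) by (simp add: M.smult_r_distr)
    then have "a \<odot>\<^bsub>A\<^esub> z \<in> I +>\<^bsub>A\<^esub> (a \<odot>\<^bsub>A\<^esub> x)"
      using assms(5)[OF y(1)] by (auto simp: a_r_coset_def')
    then show ?thesis
      using assms(3,4) M.smult_closed a_subgroup by (intro a_repr_independence[symmetric]) auto
  qed
  have "x \<in> I +>\<^bsub>A\<^esub> x"
    using assms(4) by (rule a_rcos_self)
  then have "(\<Union>z\<in>I +>\<^bsub>A\<^esub> x. I +>\<^bsub>A\<^esub> (a \<odot>\<^bsub>A\<^esub> x)) = I +>\<^bsub>A\<^esub> (a \<odot>\<^bsub>A\<^esub> x)"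
    by blast
  moreover have "(\<Union>z\<in>I +>\<^bsub>A\<^esub> x. I +>\<^bsub>A\<^esub> (a \<odot>\<^bsub>A\<^esub> z)) =
      (\<Union>z\<in>I +>\<^bsub>A\<^esub> x. I +>\<^bsub>A\<^esub> (a \<odot>\<^bsub>A\<^esub> x))"
    by (intro SUP_cong HOL.refl eq)
  ultimately show ?thesis
    by (simp add: quot_algebra_def ring.defs)
qed

lemma module_quot_algebra:
  fixes R (structure)
  assumes I: "ideal I A" and A: "module R A"
    and cl: "\<And>a y. a \<in> carrier R \<Longrightarrow> y \<in> I \<Longrightarrow> a \<odot>\<^bsub>A\<^esub> y \<in> I"
  shows "module R (quot_algebra A I)"
proof -
  interpret I: ideal I A by fact
  interpret M: module R A by fact
  interpret Q: ring "quot_algebra A I"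
    using I by (rule ring_quot_algebra)
  have carr: "carrier (quot_algebra A I) = (\<lambda>x. I +>\<^bsub>A\<^esub> x) ` carrier A"
    by (auto simp: quot_algebra_simps FactRing_simps)
  have add: "(I +>\<^bsub>A\<^esub> x) \<oplus>\<^bsub>quot_algebra A I\<^esub> (I +>\<^bsub>A\<^esub> y) = I +>\<^bsub>A\<^esub> (x \<oplus>\<^bsub>A\<^esub> y)"
    if "x \<in> carrier A" "y \<in> carrier A" for x y
    using that by (simp add: quot_algebra_simps FactRing_def I.a_rcos_sum)
  have sm: "a \<odot>\<^bsub>quot_algebra A I\<^esub> (I +>\<^bsub>A\<^esub> x) = I +>\<^bsub>A\<^esub> (a \<odot>\<^bsub>A\<^esub> x)"
    if "a \<in> carrier R" "x \<in> carrier A" for a x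
    by (rule quot_algebra_smult[OF I A that]) (rule cl[OF that(1)])
  show ?thesis
  proof (rule moduleI)
    show "cring R"
      by (rule M.R.is_cring)
    show "abelian_group (quot_algebra A I)"
      by (rule Q.is_abelian_group)
  qed (auto simp: carr add sm M.smult_l_distr M.smult_r_distr M.smult_assoc1)
qed


section \<open>The singular Hecke algebra\<close>

type_synonym K = "complex poly fract"

abbreviation K_ring :: "K ring" where
  "K_ring \<equiv> ring_of_type_algebra"

definition q :: K where
  "q = Fract [:0, 1:] 1"

abbreviation KSB :: "nat \<Rightarrow> (K, letter list set \<Rightarrow> K) module" where
  "KSB n \<equiv> monoid_algebra (SB n)"

text \<open>The left-hand side minus the right-hand side of \<open>\<sigma>\<^sub>k\<^sup>2 = (q - 1) \<sigma>\<^sub>k + q\<close>.\<close>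

definition hecke_relator :: "nat \<Rightarrow> nat \<Rightarrow> (letter list set \<Rightarrow> K)" where
  "hecke_relator n k =
    (let s = delta (braid_class n [Sig k]) in
      (s \<otimes>\<^bsub>KSB n\<^esub> s) \<ominus>\<^bsub>KSB n\<^esub> (((q - 1) \<odot>\<^bsub>KSB n\<^esub> s) \<oplus>\<^bsub>KSB n\<^esub> (q \<odot>\<^bsub>KSB n\<^esub> \<one>\<^bsub>KSB n\<^esub>)))"

definition hecke_ideal :: "nat \<Rightarrow> (letter list set \<Rightarrow> K) set" where
  "hecke_ideal n = Idl\<^bsub>KSB n\<^esub> (hecke_relator n ` {1..n-1})"

definition HSB :: "nat \<Rightarrow> (K, (letter list set \<Rightarrow> K) set) module" where
  "HSB n = quot_algebra (KSB n) (hecke_ideal n)"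

definition to_HSB :: "nat \<Rightarrow> letter list set \<Rightarrow> (letter list set \<Rightarrow> K) set" where
  "to_HSB n x = hecke_ideal n +>\<^bsub>KSB n\<^esub> delta x"

definition HSdB :: "nat \<Rightarrow> nat \<Rightarrow> (letter list set \<Rightarrow> K) set set" where
  "HSdB d n = linear_span K_ring (HSB n) (to_HSB n ` SdB d n)"

lemma ring_KSB: "ring (KSB n)"
  by (rule ring_monoid_algebra[OF monoid_SB])

lemma delta_carrier_KSB: "x \<in> carrier (SB n) \<Longrightarrow> delta x \<in> carrier (KSB n)"
  by (simp add: carrier_monoid_algebra supp_simps)

lemma hecke_relator_carrier:
  assumes "k \<in> {1..n-1}"
  shows "hecke_relator n k \<in> carrier (KSB n)"
proof -
  interpret ring "KSB n" by (rule ring_KSB)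
  interpret M: module K_ring "KSB n" by (rule module_monoid_algebra)
  have *: "a \<in> carrier K_ring" for a
    by (simp add: ring_of_type_algebra_simps)
  have "braid_class n [Sig k] \<in> carrier (SB n)"
    using assms by (simp add: carrier_SB)
  then show ?thesis
    unfolding hecke_relator_def Let_def by (simp add: delta_carrier_KSB *)
qed

lemma ideal_hecke_ideal: "ideal (hecke_ideal n) (KSB n)"
  unfolding hecke_ideal_def
  by (rule ring.genideal_ideal[OF ring_KSB]) (auto intro: hecke_relator_carrier)

lemma ring_HSB: "ring (HSB n)"
  unfolding HSB_def by (rule ring_quot_algebra[OF ideal_hecke_ideal])

lemma module_HSB: "module K_ring (HSB n)"
  unfolding HSB_def
proof (rule module_quot_algebra[OF ideal_hecke_ideal module_monoid_algebra])
  fix a y assume y: "y \<in> hecke_ideal n"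
  interpret ideal "hecke_ideal n" "KSB n" by (rule ideal_hecke_ideal)
  interpret M: module K_ring "KSB n" by (rule module_monoid_algebra)
  have *: "a \<in> carrier K_ring"
    by (simp add: ring_of_type_algebra_def)
  have yc: "y \<in> carrier (KSB n)"
    using y by (rule a_Hcarr)
  have "(a \<odot>\<^bsub>KSB n\<^esub> \<one>\<^bsub>KSB n\<^esub>) \<otimes>\<^bsub>KSB n\<^esub> y \<in> hecke_ideal n"
    using * y by (intro I_l_closed M.smult_closed) auto
  then show "a \<odot>\<^bsub>KSB n\<^esub> y \<in> hecke_ideal n"
    using yc by (simp add: smult_mult)
qed


section \<open>The spanning set\<close>

text \<open>
  \<open>U_words n\<close> and \<open>B_words n\<close> consist of words representing the elements of \<open>\<U>\<^sub>n\<close> and \<open>\<B>\<^sub>n\<close>;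
  the inclusion of the braids on \<open>n - 1\<close> strands into those on \<open>n\<close> strands is the identity on words.
  The case \<open>n = 0\<close> is a dummy value.
\<close>

definition U_words :: "nat \<Rightarrow> letter list set" where
  "U_words n = {map Sig (rev [n - j..<n]) |j. j \<le> n - 1}"

fun B_words :: "nat \<Rightarrow> letter list set" where
  "B_words 0 = {[]}"
| "B_words (Suc 0) = {[]}"
| "B_words (Suc (Suc n)) = {b @ u |b u. b \<in> B_words (Suc n) \<and> u \<in> U_words (Suc (Suc n))}"

definition C_braids :: "nat \<Rightarrow> nat \<Rightarrow> letter list set set" where
  "C_braids d n = {braid_class n (map Tau is @ b) |is b.
    length is = d \<and> set is \<subseteq> {1..n-1} \<and> b \<in> B_words n}"

end

theory Submission
  imports Defs
begin

text \<open>
  The point is that \<open>\<sigma>\<^sub>b \<tau>\<^sub>a\<close> with \<open>a\<close> and \<open>b\<close> adjacent lies in \<open>M = \<Sum>\<^sub>i \<tau>\<^sub>i H\<close>, where \<open>H\<close> is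
  the Hecke algebra; then all letters \<open>\<tau>\<close> can be moved to the left, and the remaining
  braid is reduced to \<open>\<B>\<^sub>n\<close> as in the usual Hecke algebra. The relation
  \<open>\<sigma>\<^sub>a \<sigma>\<^sub>b \<tau>\<^sub>a = \<tau>\<^sub>b \<sigma>\<^sub>a \<sigma>\<^sub>b\<close> expresses \<open>q \<sigma>\<^sub>b \<tau>\<^sub>a\<close> modulo \<open>M\<close> as \<open>\<sigma>\<^sub>a \<tau>\<^sub>b \<sigma>\<^sub>a \<sigma>\<^sub>b\<close>. Applying it twice
  gives \<open>\<sigma>\<^sub>b \<tau>\<^sub>a (q\<^sup>2 - \<sigma>\<^sub>b \<sigma>\<^sub>a \<sigma>\<^sub>a \<sigma>\<^sub>b) \<in> M\<close>, so it suffices that \<open>q\<^sup>2 - \<sigma>\<^sub>b \<sigma>\<^sub>a \<sigma>\<^sub>a \<sigma>\<^sub>b\<close> is right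
  invertible. It equals \<open>(1 - q) (\<sigma>\<^sub>b \<sigma>\<^sub>a + q) \<sigma>\<^sub>b\<close>, and the right ideal generated by
  \<open>\<sigma>\<^sub>b \<sigma>\<^sub>a + q\<close> contains successively \<open>\<sigma>\<^sub>a + \<sigma>\<^sub>b - (q - 1)\<close>, \<open>\<sigma>\<^sub>b - \<sigma>\<^sub>a\<close>, \<open>2 \<sigma>\<^sub>a - (q - 1)\<close> and
  the nonzero scalar \<open>(q + 1)\<^sup>2\<close>.
\<close>

section \<open>Braids as vectors of the monoid algebra, and the nonzero scalars\<close>

definition braid_vec :: "nat \<Rightarrow> letter list \<Rightarrow> letter list set \<Rightarrow> K" where
  "braid_vec n w = delta (braid_class n w)"

definition pure_words :: "nat \<Rightarrow> letter list set" where
  "pure_words n = {w \<in> words n. \<forall>a\<in>set w. \<not> is_tau a}"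

lemma pure_words_simps [simp]:
  "[] \<in> pure_words n"
  "a # w \<in> pure_words n \<longleftrightarrow> 1 \<le> index a \<and> index a \<le> n - 1 \<and> \<not> is_tau a \<and> w \<in> pure_words n"
  "u @ v \<in> pure_words n \<longleftrightarrow> u \<in> pure_words n \<and> v \<in> pure_words n"
  by (auto simp: pure_words_def)

lemma pure_words_subset: "w \<in> pure_words n \<Longrightarrow> w \<in> words n"
  by (simp add: pure_words_def)

lemma map_Tau_words: "map Tau js \<in> words n \<longleftrightarrow> set js \<subseteq> {1..n-1}"
  by (induction js) auto

lemma q_nonzero: "q \<noteq> 0"
  by (simp add: q_def Zero_fract_def eq_fract)

lemma q_minus_one_nonzero: "q - 1 \<noteq> 0"
  by (simp add: q_def One_fract_def Zero_fract_def eq_fract one_pCons)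

lemma q_plus_one_nonzero: "q + 1 \<noteq> 0"
  by (simp add: q_def One_fract_def Zero_fract_def eq_fract one_pCons)

lemma braid_vec_rel:
  assumes "(u, v) \<in> sb_relations n" "x \<in> words n" "y \<in> words n"
  shows "braid_vec n (x @ u @ y) = braid_vec n (x @ v @ y)"
proof -
  have "braid_class n (x @ u @ y) = braid_class n (x @ v @ y)"
    using assms sb_relations_words[OF assms(1)] sb_cong.rel[OF assms] by (simp add: braid_class_eq_iff)
  then show ?thesis by (simp add: braid_vec_def)
qed

text \<open>Serves to carry one letter across a segment of a descending word of
  \<open>U_words\<close>.\<close>

lemma braid_vec_far:
  assumes "x \<in> words n" "y \<in> words n" "1 \<le> k" "k \<le> n - 1"
    and "\<And>j. j \<in> set js \<Longrightarrow> 1 \<le> j \<and> j \<le> n - 1 \<and> \<bar>int j - int k\<bar> \<ge> 2"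
  shows "braid_vec n (x @ map Sig js @ Sig k # y) = braid_vec n (x @ Sig k # map Sig js @ y)"
  using assms
proof (induction js arbitrary: x)
  case (Cons j js)
  have "map Sig js \<in> words n"
    using Cons.prems(5) by (auto simp: words_def)
  moreover have "braid_vec n ((x @ [Sig j]) @ map Sig js @ Sig k # y) =
      braid_vec n ((x @ [Sig j]) @ Sig k # map Sig js @ y)"
    using Cons.prems by (intro Cons.IH) auto
  ultimately show ?case
    using braid_vec_rel[OF sb_relations.far_sig_sig[of j n k], of x "map Sig js @ y"] Cons.prems by simp
qed simp

text \<open>
  \<open>P\<close> plays the role of the preimage in \<open>K[SB\<^sub>n]\<close> of a subspace of the singular Hecke algebra.
\<close>

locale hecke_subspace =
  fixes n :: nat and P :: "(letter list set \<Rightarrow> K) set"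
  assumes add: "f \<in> P \<Longrightarrow> g \<in> P \<Longrightarrow> (\<lambda>Z. f Z + g Z) \<in> P"
    and scale: "f \<in> P \<Longrightarrow> (\<lambda>Z. c * f Z) \<in> P"
    and quad: "x \<in> words n \<Longrightarrow> y \<in> words n \<Longrightarrow> k \<in> {1..n-1} \<Longrightarrow>
      (\<lambda>Z. braid_vec n (x @ Sig k # Sig k # y) Z -
        (q - 1) * braid_vec n (x @ Sig k # y) Z - q * braid_vec n (x @ y) Z) \<in> P"
begin

abbreviation D :: "letter list \<Rightarrow> letter list set \<Rightarrow> K" where
  "D \<equiv> braid_vec n"

text \<open>Typical use: \<open>g\<close> is an explicit linear combination of known members, and
  equality is checked pointwise in the field.\<close>

lemma mem_eq: "g \<in> P \<Longrightarrow> (\<And>Z. f Z = g Z) \<Longrightarrow> f \<in> P"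
  by (metis ext)

lemma cancel_scale:
  assumes "(\<lambda>Z. c * f Z) \<in> P" "c \<noteq> 0"
  shows "f \<in> P"
  by (rule mem_eq[OF scale[OF assms(1), of "inverse c"]]) (use assms(2) in simp)

lemma quad_mem:
  assumes "x \<in> words n" "y \<in> words n" "k \<in> {1..n-1}" "D (x @ Sig k # y) \<in> P" "D (x @ y) \<in> P"
  shows "D (x @ Sig k # Sig k # y) \<in> P"
  by (rule mem_eq[OF add[OF quad[OF assms(1-3)] add[OF scale[OF assms(4), of "q - 1"] scale[OF assms(5), of q]]]])
    (simp add: algebra_simps)

text \<open>Multiplying the quadratic relation by the inverse of \<open>\<sigma>\<^sub>k\<close>
  gives a linear expression for that inverse.\<close>

lemma inv_rel:
  assumes "x \<in> words n" "y \<in> words n" "k \<in> {1..n-1}"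
  shows "(\<lambda>Z. q * D (x @ SigInv k # y) Z - D (x @ Sig k # y) Z + (q - 1) * D (x @ y) Z) \<in> P"
proof -
  have "D (x @ Sig k # y) = D (x @ SigInv k # Sig k # Sig k # y)"
    using braid_vec_rel[OF sb_relations.inv_sig[OF assms(3)], of x "Sig k # y"] assms by simp
  moreover have "D (x @ y) = D (x @ SigInv k # Sig k # y)"
    using braid_vec_rel[OF sb_relations.inv_sig[OF assms(3)], of x y] assms by simp
  ultimately show ?thesis
    using quad[of "x @ [SigInv k]" y k] assms
    by (intro mem_eq[OF scale[OF quad[of "x @ [SigInv k]" y k], of "- 1"]]) (simp_all add: algebra_simps)
qed

lemma inv_mem:
  assumes "x \<in> words n" "y \<in> words n" "k \<in> {1..n-1}" "D (x @ Sig k # y) \<in> P" "D (x @ y) \<in> P"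
  shows "D (x @ SigInv k # y) \<in> P"
  by (rule cancel_scale[OF _ q_nonzero], rule mem_eq[OF add[OF inv_rel[OF assms(1-3)]
        add[OF assms(4) scale[OF assms(5), of "1 - q"]]]])
    (simp add: algebra_simps)

section \<open>Moving the letters \<tau> to the left\<close>

lemma adjacent_shift:
  assumes ab: "a \<in> {1..n-1}" "b \<in> {1..n-1}" "\<bar>int a - int b\<bar> = 1"
    and "x \<in> words n" "v \<in> words n" and mem: "D (x @ Tau b # Sig a # Sig b # v) \<in> P"
  shows "(\<lambda>Z. q * D (x @ Sig b # Tau a # v) Z - D (x @ Sig a # Tau b # Sig a # Sig b # v) Z) \<in> P"
proof -
  \<comment> \<open>The mixed braid relation rewrites \<open>\<sigma>\<^sub>b \<tau>\<^sub>a\<close>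
    with the inverse of \<open>\<sigma>\<^sub>a\<close> in front; expanding it by
    \<open>inv_rel\<close> leaves, besides the wanted term, a multiple of the vector in
    \<open>mem\<close>.\<close>
  have "D (x @ SigInv a # Tau b # Sig a # Sig b # v) = D (x @ SigInv a # Sig a # Sig b # Tau a # v)"
    using braid_vec_rel[OF sb_relations.braid_tau[OF ab], of "x @ [SigInv a]" v] assms by simp
  also have "\<dots> = D (x @ Sig b # Tau a # v)"
    using braid_vec_rel[OF sb_relations.inv_sig[OF ab(1)], of x "Sig b # Tau a # v"] assms by simp
  finally have eq: "D (x @ SigInv a # Tau b # Sig a # Sig b # v) = D (x @ Sig b # Tau a # v)" .
  have "x \<in> words n" "Tau b # Sig a # Sig b # v \<in> words n"
    using assms by auto
  note * = inv_rel[OF this ab(1), unfolded eq]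
  show ?thesis
    by (rule mem_eq[OF add[OF * scale[OF mem, of "1 - q"]]]) (simp add: algebra_simps)
qed

text \<open>By \<open>mem\<close>, \<open>P\<close> contains the part of \<open>M\<close> with
  \<open>x\<close> in front and \<open>y\<close> behind. The facts below hold for every pure
  \<open>w\<close>, which expresses stability under right multiplication and so amounts to computing
  in a right ideal.\<close>

lemma adjacent_swap:
  assumes ab: "a \<in> {1..n-1}" "b \<in> {1..n-1}" "\<bar>int a - int b\<bar> = 1"
    and x: "x \<in> words n" and y: "y \<in> words n"
    and mem: "\<And>i z. i \<in> {1..n-1} \<Longrightarrow> z \<in> pure_words n \<Longrightarrow> D (x @ Tau i # z @ y) \<in> P"
  shows "D (x @ Sig b # Tau a # y) \<in> P"
proof -
  define f where "f w = D (x @ Sig b # Tau a # w @ y)" for w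
  have ba: "\<bar>int b - int a\<bar> = 1"
    using ab(3) by simp
  have letters [simp]: "Suc 0 \<le> a" "a \<le> n - Suc 0" "Suc 0 \<le> b" "b \<le> n - Suc 0"
    using ab by auto
  have f_quad: "(\<lambda>Z. f (u @ Sig k # Sig k # w) Z - (q - 1) * f (u @ Sig k # w) Z - q * f (u @ w) Z) \<in> P"
    if "u \<in> pure_words n" "w \<in> pure_words n" "k \<in> {1..n-1}" for u w k
    using quad[of "x @ Sig b # Tau a # u" "w @ y" k] that x y pure_words_subset
    by (simp add: f_def)
  have f_braid: "f (Sig a # Sig b # Sig a # w) = f (Sig b # Sig a # Sig b # w)"
    if "w \<in> pure_words n" for w
    using braid_vec_rel[OF sb_relations.braid[OF ab], of "x @ [Sig b, Tau a]" "w @ y"] that x y pure_words_subset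
    by (simp add: f_def)
  \<comment> \<open>The second shift exchanges the roles of \<open>a\<close> and \<open>b\<close>,
    so \<open>\<sigma>\<^sub>b \<tau>\<^sub>a\<close> reappears and the result is again a value of
    \<open>f\<close>.\<close>
  have start: "(\<lambda>Z. q * (q * f w Z) - f (Sig b # Sig a # Sig a # Sig b # w) Z) \<in> P" if w: "w \<in> pure_words n" for w
  proof -
    have 1: "(\<lambda>Z. q * f w Z - D (x @ Sig a # Tau b # Sig a # Sig b # w @ y) Z) \<in> P"
      unfolding f_def using adjacent_shift[OF ab x, of "w @ y"] mem[OF ab(2), of "Sig a # Sig b # w"] w y pure_words_subset
      by simp
    have 2: "(\<lambda>Z. q * D (x @ Sig a # Tau b # Sig a # Sig b # w @ y) Z -
        f (Sig b # Sig a # Sig a # Sig b # w) Z) \<in> P"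
      unfolding f_def using adjacent_shift[OF ab(2,1) ba x, of "Sig a # Sig b # w @ y"]
        mem[OF ab(1), of "Sig b # Sig a # Sig a # Sig b # w"] w y pure_words_subset
      by simp
    show ?thesis
      by (rule mem_eq[OF add[OF scale[OF 1, of q] 2]]) (simp add: algebra_simps)
  qed
  \<comment> \<open>Expanding both squares in \<open>start\<close> makes the terms
    \<open>q\<^sup>2 f w\<close> cancel, and \<open>1 - q\<close> factors out.\<close>
  have bab: "(\<lambda>Z. f (Sig b # Sig a # Sig b # w) Z + q * f (Sig b # w) Z) \<in> P" if w: "w \<in> pure_words n" for w
  proof (rule cancel_scale)
    have 1: "(\<lambda>Z. f (Sig b # Sig a # Sig a # Sig b # w) Z - (q - 1) * f (Sig b # Sig a # Sig b # w) Z
        - q * f (Sig b # Sig b # w) Z) \<in> P"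
      using f_quad[of "[Sig b]" "Sig b # w" a] w ab by simp
    have 2: "(\<lambda>Z. f (Sig b # Sig b # w) Z - (q - 1) * f (Sig b # w) Z - q * f w Z) \<in> P"
      using f_quad[of "[]" w b] w ab by simp
    show "(\<lambda>Z. (1 - q) * (f (Sig b # Sig a # Sig b # w) Z + q * f (Sig b # w) Z)) \<in> P"
      by (rule mem_eq[OF add[OF start[OF w] add[OF 1 scale[OF 2, of q]]]]) (simp add: algebra_simps)
    show "1 - q \<noteq> 0"
      using q_minus_one_nonzero by simp
  qed
  \<comment> \<open>The trailing \<open>\<sigma>\<^sub>b\<close> in \<open>bab\<close> is cancelled
    by applying it to \<open>SigInv b # w\<close>.\<close>
  have r: "(\<lambda>Z. f (Sig b # Sig a # w) Z + q * f w Z) \<in> P" if w: "w \<in> pure_words n" for w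
  proof -
    have "f (u @ Sig b # SigInv b # w) = f (u @ w)" if "u \<in> pure_words n" for u
      using braid_vec_rel[OF sb_relations.sig_inv[OF ab(2)], of "x @ Sig b # Tau a # u" "w @ y"] that w x y pure_words_subset
      by (simp add: f_def)
    from this[of "[Sig b, Sig a]"] this[of "[]"] show ?thesis
      using bab[of "SigInv b # w"] w by simp
  qed
  \<comment> \<open>This is \<open>r\<close> at \<open>Sig a # w\<close>, with the square of
    \<open>\<sigma>\<^sub>a\<close> expanded and \<open>\<sigma>\<^sub>b \<sigma>\<^sub>a\<close>
    replaced by \<open>- q\<close>.\<close>
  have u: "(\<lambda>Z. f (Sig b # w) Z + f (Sig a # w) Z - (q - 1) * f w Z) \<in> P" if w: "w \<in> pure_words n" for w
  proof (rule cancel_scale[OF _ q_nonzero])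
    have 1: "(\<lambda>Z. f (Sig b # Sig a # Sig a # w) Z + q * f (Sig a # w) Z) \<in> P"
      using r[of "Sig a # w"] w by simp
    have 2: "(\<lambda>Z. f (Sig b # Sig a # Sig a # w) Z - (q - 1) * f (Sig b # Sig a # w) Z - q * f (Sig b # w) Z) \<in> P"
      using f_quad[of "[Sig b]" w a] w ab by simp
    show "(\<lambda>Z. q * (f (Sig b # w) Z + f (Sig a # w) Z - (q - 1) * f w Z)) \<in> P"
      by (rule mem_eq[OF add[OF 1 add[OF scale[OF 2, of "- 1"] scale[OF r[OF w], of "1 - q"]]]])
        (simp add: algebra_simps)
  qed
  \<comment> \<open>In \<open>u\<close> at \<open>Sig b # Sig a # w\<close>, the braid relation
    turns the second term into the one handled by \<open>bab\<close>.\<close>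
  have v: "(\<lambda>Z. f (Sig b # w) Z - f (Sig a # w) Z) \<in> P" if w: "w \<in> pure_words n" for w
  proof (rule cancel_scale[OF _ q_nonzero])
    have 1: "(\<lambda>Z. f (Sig b # Sig b # Sig a # w) Z + f (Sig b # Sig a # Sig b # w) Z
        - (q - 1) * f (Sig b # Sig a # w) Z) \<in> P"
      using u[of "Sig b # Sig a # w"] w f_braid[OF w] by simp
    have 2: "(\<lambda>Z. f (Sig b # Sig b # Sig a # w) Z - (q - 1) * f (Sig b # Sig a # w) Z - q * f (Sig a # w) Z) \<in> P"
      using f_quad[of "[]" "Sig a # w" b] w ab by simp
    show "(\<lambda>Z. q * (f (Sig b # w) Z - f (Sig a # w) Z)) \<in> P"
      by (rule mem_eq[OF add[OF bab[OF w] add[OF scale[OF 1, of "- 1"] 2]]])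
        (simp add: algebra_simps)
  qed
  have t: "(\<lambda>Z. 2 * f (Sig a # w) Z - (q - 1) * f w Z) \<in> P" if w: "w \<in> pure_words n" for w
    by (rule mem_eq[OF add[OF u[OF w] scale[OF v[OF w], of "- 1"]]]) (simp add: algebra_simps)
  \<comment> \<open>Modulo \<open>P\<close>, \<open>t\<close> lets \<open>\<sigma>\<^sub>a\<close>
    act as \<open>(q - 1) / 2\<close>, where the polynomial \<open>X^2 - (q - 1) X - q\<close> takes
    the value \<open>- (q + 1)^2 / 4\<close>.\<close>
  have "f [] \<in> P"
  proof (rule cancel_scale)
    have 1: "(\<lambda>Z. 2 * f [Sig a, Sig a] Z - (q - 1) * f [Sig a] Z) \<in> P"
      using t[of "[Sig a]"] by simp
    have 2: "(\<lambda>Z. f [Sig a, Sig a] Z - (q - 1) * f [Sig a] Z - q * f [] Z) \<in> P"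
      using f_quad[of "[]" "[]" a] ab by simp
    have 3: "(\<lambda>Z. 2 * f [Sig a] Z - (q - 1) * f [] Z) \<in> P"
      using t[of "[]"] by simp
    show "(\<lambda>Z. ((q + 1) * (q + 1)) * f [] Z) \<in> P"
      by (rule mem_eq[OF add[OF scale[OF 1, of 2] add[OF scale[OF 2, of "- 4"] scale[OF 3, of "1 - q"]]]])
        (simp add: algebra_simps)
    show "(q + 1) * (q + 1) \<noteq> 0"
      using q_plus_one_nonzero by simp
  qed
  then show ?thesis by (simp add: f_def)
qed

text \<open>Equal or distant indices need only a commutation relation; an inverse letter reduces to
  \<open>\<sigma>\<^sub>k\<close> by \<open>inv_mem\<close>.\<close>

lemma tau_swap:
  assumes g: "g \<in> {Sig k, SigInv k}" and k: "k \<in> {1..n-1}" and l: "l \<in> {1..n-1}"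
    and x: "x \<in> words n" and y: "y \<in> words n"
    and mem: "\<And>i z. i \<in> {1..n-1} \<Longrightarrow> z \<in> pure_words n \<Longrightarrow> D (x @ Tau i # z @ y) \<in> P"
  shows "D (x @ g # Tau l # y) \<in> P"
proof -
  have sig: "D (x @ Sig k # Tau l # y) \<in> P"
  proof -
    consider "k = l" | "\<bar>int l - int k\<bar> = 1" | "\<bar>int k - int l\<bar> \<ge> 2" by linarith
    then show ?thesis
    proof cases
      case 1
      then show ?thesis
        using braid_vec_rel[OF sb_relations.sig_tau[OF k], of x y] mem[OF k, of "[Sig k]"] k x y by simp
    next
      case 2
      then show ?thesis
        by (intro adjacent_swap k l x y mem)
    next
      case 3
      then show ?thesis
        using braid_vec_rel[OF sb_relations.far_sig_tau[OF k l], of x y] mem[OF l, of "[Sig k]"] k x y by simp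
    qed
  qed
  moreover have "D (x @ Tau l # y) \<in> P"
    using mem[OF l, of "[]"] by simp
  ultimately show ?thesis
    using g inv_mem[of x "Tau l # y" k] k l x y by auto
qed

text \<open>Induction on the number of letters \<tau> still in \<open>w\<close>; \<open>js\<close>
  collects those already in front.\<close>

lemma tau_left:
  assumes mem: "\<And>is z. length is = d \<Longrightarrow> set is \<subseteq> {1..n-1} \<Longrightarrow> z \<in> pure_words n \<Longrightarrow> D (map Tau is @ z) \<in> P"
    and "w \<in> words n" "set js \<subseteq> {1..n-1}" "length js + length (filter is_tau w) = d"
  shows "D (map Tau js @ w) \<in> P"
  using assms(2-)
proof (induction "length (filter is_tau w)" arbitrary: js w)
  case 0
  then have "w \<in> pure_words n"
    by (simp add: pure_words_def filter_empty_conv)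
  then show ?case
    using 0 by (intro mem) auto
next
  case (Suc m)
  \<comment> \<open>The letter of \<open>s\<close> next to \<tau> is its last one, hence an
    induction from the right. A swap creates some \<open>\<tau>\<^sub>i\<close> followed by a pure
    word, so \<open>l\<close> and \<open>w'\<close> are generalized.\<close>
  have "D (map Tau js @ s @ Tau l # w') \<in> P"
    if "s \<in> pure_words n" "Tau l # w' \<in> words n" "length (filter is_tau w') = m" for s l w'
    using that
  proof (induction s arbitrary: l w' rule: rev_induct)
    case Nil
    then show ?case
      using Suc.hyps(1)[of w' "js @ [l]"] Suc.prems Suc.hyps(2) by simp
  next
    case (snoc g s)
    obtain k where k: "g \<in> {Sig k, SigInv k}" "k \<in> {1..n-1}"
      using snoc.prems(1) by (cases g) auto
    have js: "map Tau js \<in> words n"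
      using Suc.prems by (simp add: map_Tau_words)
    have "D ((map Tau js @ s) @ g # Tau l # w') \<in> P"
    proof (rule tau_swap[OF k])
      fix i z assume "i \<in> {1..n-1}" "z \<in> pure_words n"
      moreover from this(2) have "z \<in> words n" "filter is_tau z = []"
        by (simp_all add: pure_words_def filter_empty_conv)
      ultimately show "D ((map Tau js @ s) @ Tau i # z @ w') \<in> P"
        using snoc.IH[of i "z @ w'"] snoc.prems by simp
    qed (use snoc.prems js pure_words_subset in auto)
    then show ?case by simp
  qed
  moreover have "\<exists>a\<in>set w. is_tau a"
    using Suc.hyps(2) by (metis filter_False list.size(3) nat.distinct(1))
  then obtain s t w' where w: "w = s @ t # w'" "is_tau t" "\<forall>a\<in>set s. \<not> is_tau a"
    by (elim split_list_first_propE) auto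
  moreover obtain l where l: "t = Tau l"
    using w(2) by (cases t) auto
  moreover have "s \<in> pure_words n" "Tau l # w' \<in> words n"
    using w l Suc.prems(1) by (auto simp: pure_words_def)
  moreover have "length (filter is_tau w') = m"
    using w l Suc.hyps(2) by (simp add: filter_empty_conv[THEN iffD2])
  ultimately show ?case
    by blast
qed

end

section \<open>Reduction of pure words to \<open>\<B>\<^sub>n\<close>\<close>

lemma upt_split: "c \<le> m \<Longrightarrow> m \<le> M \<Longrightarrow> [c..<M] = [c..<m] @ [m..<M]"
  by (metis le_add_diff_inverse upt_add_eq_append)

text \<open>Here \<open>c = m - j\<close> is the index of the last letter; \<open>c = m\<close>
  gives the empty word.\<close>

lemma U_words_altdef: "1 \<le> m \<Longrightarrow> U_words m = {map Sig (rev [c..<m]) |c. 1 \<le> c \<and> c \<le> m}"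
  unfolding U_words_def
  by (auto intro: exI[of _ "m - _"]) (metis diff_diff_cancel diff_le_mono2)

lemma B_words_pure: "b \<in> B_words m \<Longrightarrow> m \<le> n \<Longrightarrow> b \<in> pure_words n"
proof (induction m arbitrary: b rule: B_words.induct)
  case (3 m)
  then show ?case
    by (fastforce simp: U_words_altdef pure_words_def words_def)
qed simp_all

lemma Nil_in_B_words: "[] \<in> B_words m"
proof (induction m rule: B_words.induct)
  case (3 m)
  have "[] \<in> U_words (Suc (Suc m))"
    unfolding U_words_def by (intro CollectI exI[of _ 0]) simp
  with 3 show ?case by force
qed simp_all

context hecke_subspace
begin

text \<open>Induction on \<open>m\<close>. The tail \<open>y\<close> is arbitrary so that the factor
  from \<open>U_words\<close> can be put into it when one strand is removed; the prefix
  \<open>x\<close> may contain letters \<tau>.\<close>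

lemma B_words_step:
  assumes "m \<le> n" "x \<in> words n" "y \<in> words n"
    and "\<And>b. b \<in> B_words m \<Longrightarrow> D (x @ b @ y) \<in> P"
    and "b \<in> B_words m" "1 \<le> k" "k \<le> m - 1"
  shows "D (x @ b @ Sig k # y) \<in> P"
  using assms
proof (induction m arbitrary: b k y rule: B_words.induct)
  case (3 m)
  note upt_Suc [simp del]
  let ?M = "Suc (Suc m)"
  let ?u = "\<lambda>c M. map Sig (rev [c..<M])"
  have mem: "D (x @ b @ ?u c ?M @ y) \<in> P" if "b \<in> B_words (Suc m)" "1 \<le> c" "c \<le> ?M" for b c
  proof -
    have "b @ ?u c ?M \<in> B_words ?M"
      using that by (auto simp: U_words_altdef)
    from "3.prems"(4)[OF this] show ?thesis by simp
  qed
  \<comment> \<open>\<open>\<sigma>\<^sub>k\<close> passes through \<open>\<sigma>\<^sub>m\<^sub>+\<^sub>1 \<dots> \<sigma>\<^sub>c\<close> unchanged if \<open>k + 1 < c\<close> and as \<open>\<sigma>\<^sub>k\<^sub>-\<^sub>1\<close> if \<open>k > c\<close>.\<close>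
  obtain b' c where b: "b = b' @ ?u c ?M" "b' \<in> B_words (Suc m)" "1 \<le> c" "c \<le> ?M"
    using "3.prems"(5) by (auto simp: U_words_altdef)
  have b'n: "b' \<in> words n"
    using B_words_pure[OF b(2), of n] "3.prems"(1) pure_words_subset by auto
  have un: "?u e f \<in> words n" if "1 \<le> e" "f \<le> ?M" for e f
    using that "3.prems"(1) by (auto simp: words_def)
  have step: "D (x @ b' @ Sig l # ?u c ?M @ y) \<in> P" if "1 \<le> l" "l \<le> m" for l
    using "3.IH"[of "?u c ?M @ y" b' l] "3.prems"(1-3) that b(2-4) mem un[of c ?M] by simp
  have kn: "k \<le> n - 1"
    using "3.prems" by simp
  \<comment> \<open>If \<open>k + 1 = c\<close>, the descending word gets one letter longer; if
    \<open>k = c\<close>, its last letter is squared and the quadratic relation applies.\<close>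
  consider "k + 1 < c" | "k + 1 = c" | "k = c" | "c < k" by linarith
  then show ?case
  proof cases
    case 1
    have "D ((x @ b') @ ?u c ?M @ Sig k # y) = D ((x @ b') @ Sig k # ?u c ?M @ y)"
      using 1 b b'n "3.prems" kn by (intro braid_vec_far) auto
    then show ?thesis
      using step[of k] 1 b "3.prems" by simp
  next
    case 2
    then have "?u c ?M @ [Sig k] = ?u k ?M"
      using b(4) by (simp add: upt_conv_Cons[of k])
    then show ?thesis
      using mem[OF b(2), of k] 2 "3.prems" b
      by (metis append.assoc append_Cons append_Nil le_add1 le_trans)
  next
    case 3
    then have "c \<le> Suc m"
      using "3.prems" by simp
    then have u: "?u c ?M = ?u (Suc c) ?M @ [Sig c]"
      by (subst upt_conv_Cons) simp_all
    show ?thesis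
      using quad_mem[of "x @ b' @ ?u (Suc c) ?M" y c] mem[OF b(2), of c] mem[OF b(2), of "Suc c"]
        3 b b'n un[of "Suc c" ?M] "3.prems" kn \<open>c \<le> Suc m\<close>
      by (simp add: u)
  next
    case 4
    have "k \<le> Suc m"
      using "3.prems" by simp
    \<comment> \<open>Isolates \<open>\<sigma>\<^sub>k \<sigma>\<^sub>k\<^sub>-\<^sub>1\<close> in
      the descending word: the new \<open>\<sigma>\<^sub>k\<close> commutes with all that follows
      this pair, and after a braid move \<open>\<sigma>\<^sub>k\<^sub>-\<^sub>1\<close> commutes
      with all that precedes it.\<close>
    have "[c..<?M] = [c..<k-1] @ [k-1..<?M]"
      using 4 \<open>k \<le> Suc m\<close> by (intro upt_split) auto
    also have "[k-1..<?M] = (k-1) # k # [Suc k..<?M]"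
      using 4 \<open>k \<le> Suc m\<close> by (simp add: upt_conv_Cons)
    finally have u: "?u c ?M = ?u (Suc k) ?M @ Sig k # Sig (k-1) # ?u c (k-1)"
      by simp
    have k1: "1 \<le> k - 1" "\<bar>int k - int (k - 1)\<bar> = 1" "k \<in> {1..n-1}" "k - 1 \<in> {1..n-1}"
      using 4 b kn by auto
    have uw: "?u (Suc k) ?M \<in> words n" "?u c (k-1) \<in> words n"
      using un[of "Suc k" ?M] un[of c "k-1"] b \<open>k \<le> Suc m\<close> by auto
    have "D ((x @ b' @ ?u (Suc k) ?M @ [Sig k, Sig (k-1)]) @ ?u c (k-1) @ Sig k # y) =
        D ((x @ b' @ ?u (Suc k) ?M @ [Sig k, Sig (k-1)]) @ Sig k # ?u c (k-1) @ y)"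
      using 4 b b'n "3.prems" kn k1 uw by (intro braid_vec_far) auto
    also have "\<dots> = D ((x @ b' @ ?u (Suc k) ?M) @ [Sig (k-1), Sig k, Sig (k-1)] @ ?u c (k-1) @ y)"
      using braid_vec_rel[OF sb_relations.braid[OF k1(3,4,2)], of "x @ b' @ ?u (Suc k) ?M" "?u c (k-1) @ y"]
        "3.prems" b'n uw by simp
    also have "\<dots> = D ((x @ b') @ ?u (Suc k) ?M @ Sig (k-1) # Sig k # Sig (k-1) # ?u c (k-1) @ y)"
      by simp
    also have "\<dots> = D ((x @ b') @ Sig (k-1) # ?u (Suc k) ?M @ Sig k # Sig (k-1) # ?u c (k-1) @ y)"
      using 4 b b'n "3.prems" kn k1 uw by (intro braid_vec_far) auto
    finally show ?thesis
      using step[of "k-1"] k1 \<open>k \<le> Suc m\<close> b(1) u by simp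
  qed
qed simp_all

text \<open>Starting from the empty word of \<open>\<B>\<^sub>n\<close>, the letters of
  \<open>w\<close> are absorbed one by one from the left. Each absorption involves several elements
  of \<open>\<B>\<^sub>n\<close>, hence the claim for all \<open>b\<close>.\<close>

lemma pure_mem:
  assumes x: "x \<in> words n" and mem: "\<And>b. b \<in> B_words n \<Longrightarrow> D (x @ b) \<in> P" and w: "w \<in> pure_words n"
  shows "D (x @ w) \<in> P"
proof -
  have "D (x @ b @ w) \<in> P" if "b \<in> B_words n" for b
    using w that
  proof (induction w arbitrary: b)
    case (Cons g w)
    have w: "w \<in> words n" and IH: "\<And>b. b \<in> B_words n \<Longrightarrow> D (x @ b @ w) \<in> P"
      using Cons by (simp_all add: pure_words_subset)
    have b: "b \<in> words n"
      using B_words_pure[OF Cons.prems(2) order.refl] by (rule pure_words_subset)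
    obtain k where g: "g \<in> {Sig k, SigInv k}" and k: "1 \<le> k" "k \<le> n - 1"
      using Cons.prems(1) by (cases g) auto
    have "D ((x @ b) @ Sig k # w) \<in> P"
      using B_words_step[OF order.refl x w IH Cons.prems(2) k] by simp
    moreover from this have "D ((x @ b) @ SigInv k # w) \<in> P"
      using inv_mem[of "x @ b" w k] IH[OF Cons.prems(2)] x b w k by simp
    ultimately show ?case
      using g by auto
  qed (use mem in simp)
  from this[OF Nil_in_B_words] show ?thesis by simp
qed

lemma mem_if_C_mem:
  assumes "\<And>is b. length is = d \<Longrightarrow> set is \<subseteq> {1..n-1} \<Longrightarrow> b \<in> B_words n \<Longrightarrow> D (map Tau is @ b) \<in> P"
    and "w \<in> words n" "length (filter is_tau w) = d"
  shows "D w \<in> P"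
proof -
  have "D (map Tau [] @ w) \<in> P"
  proof (rule tau_left[of d])
    fix "is" z assume *: "length is = d" "set is \<subseteq> {1..n-1}" "z \<in> pure_words n"
    then have "map Tau is \<in> words n"
      by (simp add: map_Tau_words)
    then show "D (map Tau is @ z) \<in> P"
      using assms(1)[OF *(1,2)] *(3) by (rule pure_mem)
  qed (use assms(2,3) in simp_all)
  then show ?thesis by simp
qed

end

section \<open>Transfer to the quotient algebra and its submodules\<close>

lemma mult_smult:
  fixes f g :: "'m \<Rightarrow> 'k::comm_ring_1"
  assumes "f \<in> carrier (monoid_algebra M)" "g \<in> carrier (monoid_algebra M)"
  shows "f \<otimes>\<^bsub>monoid_algebra M\<^esub> (a \<odot>\<^bsub>monoid_algebra M\<^esub> g) =
    a \<odot>\<^bsub>monoid_algebra M\<^esub> (f \<otimes>\<^bsub>monoid_algebra M\<^esub> g)"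
proof -
  have fin: "finite (supp f)" "finite (supp g)"
    using assms by (auto simp: carrier_monoid_algebra)
  show ?thesis
    unfolding monoid_algebra_simps
  proof
    fix x
    show "(f \<otimes>\<^bsub>monoid_algebra M\<^esub> (\<lambda>x. a * g x)) x = a * (f \<otimes>\<^bsub>monoid_algebra M\<^esub> g) x"
      unfolding monoid_algebra_mult[OF fin order.refl supp_simps(3)]
        monoid_algebra_mult[OF fin order.refl order.refl]
      by (simp only: sum_distrib_left mult.assoc mult.left_commute)
  qed
qed

lemma braid_vec_carrier: "w \<in> words n \<Longrightarrow> braid_vec n w \<in> carrier (KSB n)"
  unfolding braid_vec_def by (rule delta_carrier_KSB) (simp add: carrier_SB)

lemma braid_vec_mult:
  "u \<in> words n \<Longrightarrow> v \<in> words n \<Longrightarrow> braid_vec n u \<otimes>\<^bsub>KSB n\<^esub> braid_vec n v = braid_vec n (u @ v)"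
  by (simp add: braid_vec_def delta_mult mult_SB)

text \<open>Scaling by \<open>a\<close> is multiplication by \<open>a\<close> times the unit, so a
  ring ideal is a subspace.\<close>

lemma hecke_ideal_smult:
  assumes "y \<in> hecke_ideal n"
  shows "a \<odot>\<^bsub>KSB n\<^esub> y \<in> hecke_ideal n"
proof -
  interpret ideal "hecke_ideal n" "KSB n" by (rule ideal_hecke_ideal)
  interpret M: module K_ring "KSB n" by (rule module_monoid_algebra)
  have "a \<in> carrier K_ring"
    by (simp add: ring_of_type_algebra_simps)
  then have "(a \<odot>\<^bsub>KSB n\<^esub> \<one>\<^bsub>KSB n\<^esub>) \<otimes>\<^bsub>KSB n\<^esub> y \<in> hecke_ideal n"
    using assms by (intro I_l_closed M.smult_closed) auto
  then show ?thesis
    using a_Hcarr[OF assms] by (simp add: smult_mult)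
qed

text \<open>This vector is the generator \<open>hecke_relator n k\<close> multiplied by the braids
  of \<open>x\<close> and \<open>y\<close> on either side.\<close>

lemma quad_in_hecke_ideal:
  assumes x: "x \<in> words n" and y: "y \<in> words n" and k: "k \<in> {1..n-1}"
  shows "(\<lambda>Z. braid_vec n (x @ Sig k # Sig k # y) Z -
      (q - 1) * braid_vec n (x @ Sig k # y) Z - q * braid_vec n (x @ y) Z) \<in> hecke_ideal n"
proof -
  interpret ideal "hecke_ideal n" "KSB n" by (rule ideal_hecke_ideal)
  interpret M: module K_ring "KSB n" by (rule module_monoid_algebra)
  have K [simp]: "a \<in> carrier K_ring" for a
    by (simp add: ring_of_type_algebra_simps)
  let ?v = "braid_vec n"
  note [simp] = braid_vec_carrier braid_vec_mult
  \<comment> \<open>Negation as a scalar lets \<open>smult_mult\<close> and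
    \<open>mult_smult\<close> move it through products.\<close>
  have neg: "\<ominus>\<^bsub>KSB n\<^esub> f = (- 1) \<odot>\<^bsub>KSB n\<^esub> f" if "f \<in> carrier (KSB n)" for f
    by (rule minus_equality) (use that in \<open>auto simp: monoid_algebra_simps carrier_monoid_algebra supp_simps(4)\<close>)
  have s: "[Sig k] \<in> words n"
    using k by simp
  have one: "\<one>\<^bsub>KSB n\<^esub> = ?v []"
    by (simp add: monoid_algebra_simps one_SB braid_vec_def)
  have "hecke_relator n k \<in> hecke_ideal n"
    unfolding hecke_ideal_def using k
    by (intro subsetD[OF genideal_self]) (auto intro: hecke_relator_carrier)
  then have "(?v x \<otimes>\<^bsub>KSB n\<^esub> hecke_relator n k) \<otimes>\<^bsub>KSB n\<^esub> ?v y \<in> hecke_ideal n"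
    using x y by (intro I_r_closed I_l_closed) auto
  also have "hecke_relator n k = ?v [Sig k, Sig k] \<oplus>\<^bsub>KSB n\<^esub> (- 1) \<odot>\<^bsub>KSB n\<^esub>
      ((q - 1) \<odot>\<^bsub>KSB n\<^esub> ?v [Sig k] \<oplus>\<^bsub>KSB n\<^esub> q \<odot>\<^bsub>KSB n\<^esub> ?v [])"
    using s unfolding hecke_relator_def Let_def braid_vec_def[symmetric] one
    by (simp add: a_minus_def neg)
  also have "(?v x \<otimes>\<^bsub>KSB n\<^esub> \<dots>) \<otimes>\<^bsub>KSB n\<^esub> ?v y =
      ?v (x @ Sig k # Sig k # y) \<oplus>\<^bsub>KSB n\<^esub> (- 1) \<odot>\<^bsub>KSB n\<^esub>
      ((q - 1) \<odot>\<^bsub>KSB n\<^esub> ?v (x @ Sig k # y) \<oplus>\<^bsub>KSB n\<^esub> q \<odot>\<^bsub>KSB n\<^esub> ?v (x @ y))"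
    using x y k by (simp add: r_distr l_distr smult_mult mult_smult)
  finally show ?thesis
    by (simp add: monoid_algebra_simps algebra_simps)
qed

text \<open>Sums and multiples are preserved because the projection is linear; the quadratic
  relations lie in the Hecke ideal, so they project to zero, which belongs to
  \<open>W\<close>.\<close>

lemma hecke_subspace_preimage:
  assumes W: "submodule W K_ring (HSB n)"
  shows "hecke_subspace n {f \<in> carrier (KSB n). hecke_ideal n +>\<^bsub>KSB n\<^esub> f \<in> W}"
proof -
  interpret ideal "hecke_ideal n" "KSB n" by (rule ideal_hecke_ideal)
  interpret H: module K_ring "HSB n" by (rule module_HSB)
  note W' = H.submoduleE[OF W]
  have K [simp]: "a \<in> carrier K_ring" for a
    by (simp add: ring_of_type_algebra_simps)
  show ?thesis
  proof
    fix f g assume "f \<in> {f \<in> carrier (KSB n). hecke_ideal n +>\<^bsub>KSB n\<^esub> f \<in> W}"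
      "g \<in> {f \<in> carrier (KSB n). hecke_ideal n +>\<^bsub>KSB n\<^esub> f \<in> W}"
    then have fg: "f \<in> carrier (KSB n)" "g \<in> carrier (KSB n)"
      "hecke_ideal n +>\<^bsub>KSB n\<^esub> f \<in> W" "hecke_ideal n +>\<^bsub>KSB n\<^esub> g \<in> W"
      by auto
    have "(hecke_ideal n +>\<^bsub>KSB n\<^esub> f) \<oplus>\<^bsub>HSB n\<^esub> (hecke_ideal n +>\<^bsub>KSB n\<^esub> g) =
        hecke_ideal n +>\<^bsub>KSB n\<^esub> (f \<oplus>\<^bsub>KSB n\<^esub> g)"
      using fg by (simp add: HSB_def quot_algebra_simps FactRing_def a_rcos_sum)
    then have "hecke_ideal n +>\<^bsub>KSB n\<^esub> (f \<oplus>\<^bsub>KSB n\<^esub> g) \<in> W"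
      using W'(5)[OF fg(3,4)] by simp
    then show "(\<lambda>Z. f Z + g Z) \<in> {f \<in> carrier (KSB n). hecke_ideal n +>\<^bsub>KSB n\<^esub> f \<in> W}"
      using fg by (simp add: monoid_algebra_simps add_closed)
  next
    fix f and c :: K assume "f \<in> {f \<in> carrier (KSB n). hecke_ideal n +>\<^bsub>KSB n\<^esub> f \<in> W}"
    then have f: "f \<in> carrier (KSB n)" "hecke_ideal n +>\<^bsub>KSB n\<^esub> f \<in> W"
      by auto
    have "c \<odot>\<^bsub>HSB n\<^esub> (hecke_ideal n +>\<^bsub>KSB n\<^esub> f) = hecke_ideal n +>\<^bsub>KSB n\<^esub> (c \<odot>\<^bsub>KSB n\<^esub> f)"
      unfolding HSB_def using f
      by (intro quot_algebra_smult[OF ideal_axioms module_monoid_algebra] hecke_ideal_smult) auto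
    then have "hecke_ideal n +>\<^bsub>KSB n\<^esub> (c \<odot>\<^bsub>KSB n\<^esub> f) \<in> W"
      using W'(4)[OF K f(2), of c] by simp
    then show "(\<lambda>Z. c * f Z) \<in> {f \<in> carrier (KSB n). hecke_ideal n +>\<^bsub>KSB n\<^esub> f \<in> W}"
      using f by (simp add: monoid_algebra_simps Defs.smult_closed)
  next
    fix x y k assume "x \<in> words n" "y \<in> words n" "k \<in> {1..n-1}"
    note I = quad_in_hecke_ideal[OF this]
    have "\<zero>\<^bsub>HSB n\<^esub> \<in> W"
      using W by (metis submodule_def subgroup.one_closed monoid.simps(2) partial_object.simps(3))
    moreover have "\<zero>\<^bsub>HSB n\<^esub> = hecke_ideal n"
      by (simp add: HSB_def quot_algebra_simps FactRing_def)
    ultimately show "(\<lambda>Z. braid_vec n (x @ Sig k # Sig k # y) Z -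
        (q - 1) * braid_vec n (x @ Sig k # y) Z - q * braid_vec n (x @ y) Z)
        \<in> {f \<in> carrier (KSB n). hecke_ideal n +>\<^bsub>KSB n\<^esub> f \<in> W}"
      using I a_Hcarr[OF I] a_rcos_zero[OF ideal_axioms I] by simp
  qed
qed

section \<open>Comparison of the two spans\<close>

lemma C_braids_subset: "C_braids d n \<subseteq> SdB d n"
proof
  fix Z assume "Z \<in> C_braids d n"
  then obtain "is" b where Z: "Z = braid_class n (map Tau is @ b)" "length is = d"
    "set is \<subseteq> {1..n-1}" "b \<in> B_words n"
    by (auto simp: C_braids_def)
  moreover have "b \<in> words n" "filter is_tau b = []"
    using B_words_pure[OF Z(4) order.refl] by (simp_all add: pure_words_def filter_empty_conv)
  moreover have "map Tau is \<in> words n"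
    using Z(3) by (simp add: map_Tau_words)
  moreover have "filter is_tau (map Tau is) = map Tau is"
    by (simp add: filter_map comp_def)
  ultimately have "map Tau is @ b \<in> {w \<in> words n. length (filter is_tau w) = d}"
    by simp
  then show "Z \<in> SdB d n"
    unfolding SdB_def Z(1) by (rule imageI)
qed

lemma to_HSB_SdB_mem:
  assumes W: "submodule W K_ring (HSB n)" and C: "to_HSB n ` C_braids d n \<subseteq> W"
  shows "to_HSB n ` SdB d n \<subseteq> W"
proof -
  interpret hecke_subspace n "{f \<in> carrier (KSB n). hecke_ideal n +>\<^bsub>KSB n\<^esub> f \<in> W}"
    using W by (rule hecke_subspace_preimage)
  have "D w \<in> {f \<in> carrier (KSB n). hecke_ideal n +>\<^bsub>KSB n\<^esub> f \<in> W}"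
    if w: "w \<in> words n" "length (filter is_tau w) = d" for w
  proof (rule mem_if_C_mem[OF _ w])
    fix "is" b assume *: "length is = d" "set is \<subseteq> {1..n-1}" "b \<in> B_words n"
    then have "to_HSB n (braid_class n (map Tau is @ b)) \<in> W"
      unfolding C_braids_def by (intro subsetD[OF C[unfolded C_braids_def]] imageI) blast
    moreover have "map Tau is @ b \<in> words n"
      using *(2) pure_words_subset[OF B_words_pure[OF *(3) order.refl]] by (simp add: map_Tau_words)
    ultimately show "D (map Tau is @ b) \<in> {f \<in> carrier (KSB n). hecke_ideal n +>\<^bsub>KSB n\<^esub> f \<in> W}"
      using braid_vec_carrier[of "map Tau is @ b" n] by (simp add: to_HSB_def braid_vec_def)
  qed
  then have "to_HSB n (braid_class n w) \<in> W" if "w \<in> words n" "length (filter is_tau w) = d" for w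
    using that unfolding to_HSB_def braid_vec_def by blast
  then show ?thesis
    unfolding SdB_def by blast
qed

theorem proposition3p1:
  fixes d n :: nat
  assumes "n \<ge> 2"
  shows "linear_span K_ring (HSB n) (to_HSB n ` C_braids d n) = HSdB d n"
proof -
  \<comment> \<open>\<open>hull\<close> intersects all submodules containing a set, so the spans
    agree once both sets lie in the same submodules.\<close>
  have "submodule W K_ring (HSB n) \<and> to_HSB n ` C_braids d n \<subseteq> W \<longleftrightarrow>
      submodule W K_ring (HSB n) \<and> to_HSB n ` SdB d n \<subseteq> W" for W
    using to_HSB_SdB_mem[of W n d] image_mono[OF C_braids_subset, of "to_HSB n" d n] by (meson order.trans)
  then show ?thesis
    unfolding HSdB_def linear_span_def hull_def by (simp only:)
qed

end
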